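(* Let $f:[0,1]\to[0,1]$ be a function such that (1) $f$ is monotonically increasing (in the weak sense: $v_1\le v_2$ implies $f(v_1)\le f(v_2)$) with $f(1)=1$; (2) $f(v)\ge v$ for all $v\in[0,1]$; (3) $\dfrac{f(v_2)-f(v_1)}{v_2-v_1}\le 1$ for all $v_1,v_2\in[0,1]$ with $v_1\neq v_2$. Define $g:[0,1]\to[0,1]$ by $$g(x)=\begin{cases}\inf\{v\in[0,1]:\ f(v)\ge x\}, & x\ge f(0),\\ \sup\{v\in[0,1]:\ f(v)-v\ge x\}, & x<f(0).\end{cases}$$ Let $(U,V)$ be a pair of random variables, each uniformly distributed on $[0,1]$, whose joint cumulative distribution function on $[0,1]^2$ is the copula $C$. Then for all $u,v\in[0,1]$, $$\mathbb{P}\left(U\le u,\ g(V)\le v\right)=C(u,f(v))-C(u,f(v)-v),$$ and $g(V)$ is uniformly distributed on $[0,1]$; that is, $g$ is a measure-preserving function.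
   Context: A (bivariate) copula is a function $C:[0,1]^2\to[0,1]$ with $C(u,0)=C(0,v)=0$, $C(u,1)=u$, $C(1,v)=v$ for all $u,v\in[0,1]$, and $C(u_2,v_2)-C(u_2,v_1)-C(u_1,v_2)+C(u_1,v_1)\ge 0$ whenever $u_1\le u_2$ and $v_1\le v_2$ in $[0,1]$; equivalently, it is the restriction to $[0,1]^2$ of the joint cumulative distribution function of two random variables each uniformly distributed on $[0,1]$. A function $g:[0,1]\to[0,1]$ is called measure-preserving if, whenever a random variable $U$ is uniformly distributed on $[0,1]$, the random variable $g(U)$ is also uniformly distributed on $[0,1]$. *)

theory Defs
  imports "HOL-Probability.Probability"
begin

text \<open>Functions on \<open>[0,1]\<close> are functions on \<^typ>\<open>real\<close> that are only constrained on \<^term>\<open>{0..1::real}\<close>.\<close>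

definition copula :: "(real \<Rightarrow> real \<Rightarrow> real) \<Rightarrow> bool" where
  "copula C \<longleftrightarrow>
     (\<forall>u\<in>{0..1}. \<forall>v\<in>{0..1}. C u v \<in> {0..1}) \<and>
     (\<forall>u\<in>{0..1}. C u 0 = 0 \<and> C u 1 = u) \<and>
     (\<forall>v\<in>{0..1}. C 0 v = 0 \<and> C 1 v = v) \<and>
     (\<forall>u1\<in>{0..1}. \<forall>u2\<in>{0..1}. \<forall>v1\<in>{0..1}. \<forall>v2\<in>{0..1}.
        u1 \<le> u2 \<longrightarrow> v1 \<le> v2 \<longrightarrow> C u2 v2 - C u2 v1 - C u1 v2 + C u1 v1 \<ge> 0)"

text \<open>The condition \<^const>\<open>distributed\<close> includes measurability of the random variable; values
  outside \<open>[0,1]\<close> are possible on a null set.\<close>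

definition uniform01 :: "'a measure \<Rightarrow> ('a \<Rightarrow> real) \<Rightarrow> bool" where
  "uniform01 M U \<longleftrightarrow>
     distributed M lborel U (\<lambda>x. indicator {0..1} x / measure lborel {0..1::real})"

text \<open>A formula cannot quantify over types, so the type of the sample spaces is a parameter.
  The random variables are required to be \<open>[0,1]\<close>-valued everywhere, so that the property does not
  depend on the values of \<open>g\<close> outside \<open>[0,1]\<close>.\<close>

definition measure_preserving01 :: "'a itself \<Rightarrow> (real \<Rightarrow> real) \<Rightarrow> bool" where
  "measure_preserving01 T g \<longleftrightarrow>
     g \<in> {0..1} \<rightarrow> {0..1} \<and>
     (\<forall>(M :: 'a measure) U. prob_space M \<longrightarrow> U \<in> space M \<rightarrow> {0..1} \<longrightarrow>
        uniform01 M U \<longrightarrow> uniform01 M (\<lambda>\<omega>. g (U \<omega>)))"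

definition g_of :: "(real \<Rightarrow> real) \<Rightarrow> real \<Rightarrow> real" where
  "g_of f x = (if x \<ge> f 0 then Inf {v \<in> {0..1}. f v \<ge> x} else Sup {v \<in> {0..1}. f v - v \<ge> x})"

end

theory Submission
  imports Defs
begin

text \<open>
  The function \<open>f\<close> is continuous and increasing, and \<open>v \<mapsto> f v - v\<close> is continuous and decreasing.
  Hence both branches of \<open>g\<close> are generalised inverses, and the sublevel set \<open>{x. g x \<le> v}\<close> in
  \<open>[0,1]\<close> is the interval from \<open>f v - v\<close> to \<open>f v\<close>, up to its left endpoint. That point is a null
  event for \<open>V\<close>, so \<open>P(U \<le> u, g(V) \<le> v)\<close> is a difference of two values of the joint distribution
  function. Dropping the condition on \<open>U\<close> gives \<open>P(g(V) \<le> v) = f v - (f v - v) = v\<close>.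
\<close>

locale slope_le_one =
  fixes f :: "real \<Rightarrow> real"
  assumes range: "f \<in> {0..1} \<rightarrow> {0..1}"
    and mono: "mono_on {0..1} f"
    and one: "f 1 = 1"
    and ge_id: "\<And>v. v \<in> {0..1} \<Longrightarrow> v \<le> f v"
    and slope: "\<And>v w. \<lbrakk>v \<in> {0..1}; w \<in> {0..1}; v \<noteq> w\<rbrakk> \<Longrightarrow> (f w - f v) / (w - v) \<le> 1"
begin

text \<open>The slope bound without a denominator; equivalently, \<open>f v - v\<close> is
  decreasing in \<open>v\<close>.\<close>

lemma diff_le:
  assumes "v \<in> {0..1}" "w \<in> {0..1}" "v \<le> w"
  shows "f w - f v \<le> w - v"
  using slope[of v w] assms by (cases "v = w") (auto simp: divide_le_eq)

lemma continuous: "continuous_on {0..1} f"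
proof (rule lipschitz_on_continuous_on)
  show "1-lipschitz_on {0..1} f"
  proof (rule lipschitz_onI)
    fix v w :: real assume "v \<in> {0..1}" "w \<in> {0..1}"
    then show "dist (f v) (f w) \<le> 1 * dist v w"
      using diff_le[of v w] diff_le[of w v] mono_onD[OF mono, of v w] mono_onD[OF mono, of w v]
      by (cases "v \<le> w") (auto simp: dist_real_def)
  qed simp
qed

lemma closed_superlevel: "closed {v \<in> {0..1}. x \<le> f v}"
  using continuous_closed_preimage[OF continuous closed_atLeastAtMost closed_atLeast[of x]]
  by (simp add: vimage_def Int_def)

lemma closed_superlevel_diff: "closed {v \<in> {0..1}. x \<le> f v - v}"
  using continuous_closed_preimage[OF _ closed_atLeastAtMost closed_atLeast[of x],
      of 0 1 "\<lambda>v. f v - v"]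
  by (simp add: vimage_def Int_def continuous_on_diff continuous)

text \<open>The superlevel set is closed and contains 1, so its infimum is attained; monotonicity of
  \<open>f\<close> carries the bound to all larger points.\<close>

lemma g_of_le_iff_upper:
  assumes "f 0 \<le> x" "x \<le> 1" "v \<in> {0..1}"
  shows "g_of f x \<le> v \<longleftrightarrow> x \<le> f v"
proof -
  let ?S = "{v \<in> {0..1}. x \<le> f v}"
  have g: "g_of f x = Inf ?S" using assms by (simp add: g_of_def)
  have bdd: "bdd_below ?S" by (rule bdd_belowI[of _ 0]) auto
  have "?S \<noteq> {}" using assms one by (auto intro!: exI[of _ 1])
  then have "Inf ?S \<in> ?S"
    using closed_contains_Inf[OF _ bdd closed_superlevel] by blast
  moreover have "x \<le> f v \<Longrightarrow> Inf ?S \<le> v"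
    using assms by (intro cInf_lower bdd) auto
  ultimately show ?thesis
    using mono_onD[OF mono, of "Inf ?S" v] assms unfolding g by fastforce
qed

text \<open>Dual argument: the supremum is attained and \<open>f v - v\<close> decreases. This
  controls \<open>v \<le> g_of f x\<close>, not the reverse inequality needed for the distribution
  function.\<close>

lemma le_g_of_iff_lower:
  assumes "0 \<le> x" "x < f 0" "v \<in> {0..1}"
  shows "v \<le> g_of f x \<longleftrightarrow> x \<le> f v - v"
proof -
  let ?S = "{v \<in> {0..1}. x \<le> f v - v}"
  have g: "g_of f x = Sup ?S" using assms by (simp add: g_of_def)
  have bdd: "bdd_above ?S" by (rule bdd_aboveI[of _ 1]) auto
  have "?S \<noteq> {}" using assms by (auto intro!: exI[of _ 0])
  then have "Sup ?S \<in> ?S"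
    using closed_contains_Sup[OF _ bdd closed_superlevel_diff] by blast
  moreover have "x \<le> f v - v \<Longrightarrow> v \<le> Sup ?S"
    using assms by (intro cSup_upper bdd) auto
  ultimately show ?thesis
    using diff_le[of v "Sup ?S"] assms unfolding g by fastforce
qed

lemma g_of_range: "x \<in> {0..1} \<Longrightarrow> g_of f x \<in> {0..1}"
proof -
  assume x: "x \<in> {0..1}"
  let ?S = "{v \<in> {0..1}. x \<le> f v}" and ?T = "{v \<in> {0..1}. x \<le> f v - v}"
  show ?thesis
  proof (cases "f 0 \<le> x")
    case True
    have "1 \<in> ?S" using x one by auto
    then have "0 \<le> Inf ?S" "Inf ?S \<le> 1"
      by (auto intro!: cInf_greatest cInf_lower bdd_belowI[of _ 0])
    then show ?thesis using True by (simp add: g_of_def)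
  next
    case False
    have "0 \<in> ?T" using False by auto
    then have "0 \<le> Sup ?T" "Sup ?T \<le> 1"
      by (auto intro!: cSup_least cSup_upper bdd_aboveI[of _ 1])
    then show ?thesis using False by (simp add: g_of_def)
  qed
qed

text \<open>Every \<open>w > v\<close> exceeds \<open>g_of f x\<close>, so
  \<open>f w - w < x\<close>; letting \<open>w\<close> decrease to \<open>v\<close> leaves only a
  weak inequality.\<close>

lemma diff_le_of_g_of_le:
  assumes "0 \<le> x" "x < f 0" "v \<in> {0..1}" "g_of f x \<le> v"
  shows "f v - v \<le> x"
proof (rule field_le_epsilon)
  fix e :: real assume "0 < e"
  show "f v - v \<le> x + e"
  proof (cases "v = 1")
    \<comment> \<open>There is no room to the right of 1, but \<open>f 1 - 1 = 0\<close>.\<close>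
    case True
    then show ?thesis using one assms \<open>0 < e\<close> by simp
  next
    case False
    define w where "w = min 1 (v + e)"
    have w: "w \<in> {0..1}" "v < w" "w \<le> v + e"
      using assms False \<open>0 < e\<close> by (auto simp: w_def)
    then have "f w - w < x" using le_g_of_iff_lower[of x w] assms by auto
    moreover have "f v \<le> f w" using mono_onD[OF mono, of v w] w assms by auto
    ultimately show ?thesis using w by linarith
  qed
qed

text \<open>In each branch one bound is automatic: \<open>f v - v \<le> f 0\<close> in the upper
  one, \<open>f 0 \<le> f v\<close> in the lower one. At the excluded point,
  \<open>g_of f x = v\<close> can occur although the strict bound fails.\<close>

lemma g_of_le_iff:
  assumes "x \<in> {0..1}" "v \<in> {0..1}" "x \<noteq> f v - v"
  shows "g_of f x \<le> v \<longleftrightarrow> f v - v < x \<and> x \<le> f v"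
proof (cases "f 0 \<le> x")
  case True
  have "f v - v \<le> f 0" using diff_le[of 0 v] assms by auto
  then show ?thesis using True g_of_le_iff_upper[of x v] assms by auto
next
  case False
  have "f 0 \<le> f v" using mono_onD[OF mono, of 0 v] assms by auto
  then show ?thesis
    using False assms diff_le_of_g_of_le[of x v] le_g_of_iff_lower[of x v] by auto
qed

text \<open>For \<open>x > 1\<close> the value \<open>g x\<close> is the unspecified constant \<open>Inf {}\<close>, whence the third piece.\<close>

lemma borel_measurable_g_of [measurable]: "g_of f \<in> borel_measurable borel"
proof (rule measurable_piecewise_restrict)
  show "countable {{..<f 0}, {f 0..1}, {1<..}}" by simp
  show "A \<inter> space borel \<in> sets borel" if "A \<in> {{..<f 0}, {f 0..1}, {1<..}}" for A
    using that by auto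
  show "space borel \<subseteq> \<Union> {{..<f 0}, {f 0..1}, {1<..}}" by auto
  show "g_of f \<in> borel_measurable (restrict_space borel A)"
    if A: "A \<in> {{..<f 0}, {f 0..1}, {1<..}}" for A
  proof -
    consider "A = {..<f 0}" | "A = {f 0..1}" | "A = {1<..}" using A by auto
    then show ?thesis
    proof cases
      case 1
      \<comment> \<open>Raising \<open>x\<close> shrinks the superlevel set, so this branch is
        decreasing. The point 0 keeps the set nonempty, also for negative \<open>x\<close>.\<close>
      have "mono_on A (\<lambda>x. - g_of f x)"
      proof (rule mono_onI)
        fix x y assume xy: "x \<in> A" "y \<in> A" "x \<le> y"
        have "Sup {v \<in> {0..1}. f v - v \<ge> y} \<le> Sup {v \<in> {0..1}. f v - v \<ge> x}"
          using xy 1 by (intro cSup_subset_mono bdd_aboveI[of _ 1]) (auto intro!: exI[of _ 0])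
        then show "- g_of f x \<le> - g_of f y" using xy 1 by (simp add: g_of_def)
      qed
      then have "(\<lambda>x. - g_of f x) \<in> borel_measurable (restrict_space borel A)"
        by (rule borel_measurable_mono_on_fnc)
      then show ?thesis by simp
    next
      case 2
      have "mono_on A (g_of f)"
      proof (rule mono_onI)
        fix x y assume xy: "x \<in> A" "y \<in> A" "x \<le> y"
        have "Inf {v \<in> {0..1}. f v \<ge> x} \<le> Inf {v \<in> {0..1}. f v \<ge> y}"
          using xy 2 one by (intro cInf_superset_mono bdd_belowI[of _ 0]) (auto intro!: exI[of _ 1])
        then show "g_of f x \<le> g_of f y" using xy 2 by (simp add: g_of_def)
      qed
      then show ?thesis by (rule borel_measurable_mono_on_fnc)
    next
      case 3
      have "g_of f x = Inf {}" if "x \<in> A" for x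
      proof -
        have "f v \<le> 1" if "v \<in> {0..1}" for v
          using range that by auto
        then have "f 0 \<le> 1" "{v \<in> {0..1}. f v \<ge> x} = {}"
          using \<open>x \<in> A\<close> 3 by force+
        then show ?thesis using that 3 by (simp only: g_of_def) auto
      qed
      then show ?thesis
        by (subst measurable_cong[where g = "\<lambda>_. Inf {}"]) (auto simp: space_restrict_space)
    qed
  qed
qed

text \<open>The event \<open>Q\<close> is left open to serve both the joint law
  (\<open>U \<omega> \<le> u\<close>) and the marginal law (always true).\<close>

lemma prob_g_of_le:
  assumes "prob_space M" and V: "uniform01 M V" and v: "v \<in> {0..1}"
    and Q [measurable]: "Measurable.pred M Q"
  shows "\<P>(\<omega> in M. Q \<omega> \<and> g_of f (V \<omega>) \<le> v) =
    \<P>(\<omega> in M. Q \<omega> \<and> V \<omega> \<le> f v) - \<P>(\<omega> in M. Q \<omega> \<and> V \<omega> \<le> f v - v)"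
proof -
  interpret prob_space M by fact
  have D: "distributed M lborel V (\<lambda>x. indicator {0..1} x / measure lborel {0..1::real})"
    using V by (simp add: uniform01_def)
  have [measurable]: "V \<in> borel_measurable M" using distributed_measurable[OF D] by simp
  \<comment> \<open>\<open>V\<close> has a density supported on [0,1], so values outside and the
    exceptional point of \<open>g_of_le_iff\<close> are null events.\<close>
  have "AE \<omega> in M. V \<omega> \<in> {0..1} \<and> V \<omega> \<noteq> f v - v"
    using AE_lborel_singleton[of "f v - v"]
    by (subst distributed_AE2[OF D]) (auto elim!: eventually_mono split: split_indicator)
  then have "\<P>(\<omega> in M. Q \<omega> \<and> g_of f (V \<omega>) \<le> v) =
      \<P>(\<omega> in M. Q \<omega> \<and> f v - v < V \<omega> \<and> V \<omega> \<le> f v)"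
    using v by (intro prob_eq_AE) (erule eventually_mono, simp_all add: g_of_le_iff)
  also have "{\<omega> \<in> space M. Q \<omega> \<and> f v - v < V \<omega> \<and> V \<omega> \<le> f v} =
      {\<omega> \<in> space M. Q \<omega> \<and> V \<omega> \<le> f v} - {\<omega> \<in> space M. Q \<omega> \<and> V \<omega> \<le> f v - v}"
    by auto
  also have "prob \<dots> = \<P>(\<omega> in M. Q \<omega> \<and> V \<omega> \<le> f v) - \<P>(\<omega> in M. Q \<omega> \<and> V \<omega> \<le> f v - v)"
    \<comment> \<open>Since \<open>v \<ge> 0\<close>, the subtracted event is contained in the
      first.\<close>
    using v by (intro finite_measure_Diff) auto
  finally show ?thesis .
qed

lemma value_mem: "v \<in> {0..1} \<Longrightarrow> f v \<in> {0..1}"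
  using range by auto

text \<open>Here \<open>v \<le> f v\<close> enters: the distribution functions are known only at
  arguments in [0,1].\<close>

lemma diff_mem: "v \<in> {0..1} \<Longrightarrow> f v - v \<in> {0..1}"
  using value_mem[of v] ge_id[of v] by auto

lemma uniform01_g_of:
  assumes "prob_space M" and V: "uniform01 M V"
  shows "uniform01 M (\<lambda>\<omega>. g_of f (V \<omega>))"
proof -
  interpret prob_space M by fact
  have [measurable]: "V \<in> borel_measurable M"
    and cdf: "\<And>t. t \<in> {0..1} \<Longrightarrow> \<P>(\<omega> in M. V \<omega> \<le> t) = t"
    using V unfolding uniform01_def uniform_distributed_iff by auto
  have "\<P>(\<omega> in M. g_of f (V \<omega>) \<le> v) = v" if v: "v \<in> {0..1}" for v
    using prob_g_of_le[OF assms v, of "\<lambda>_. True"] cdf[OF value_mem[OF v]] cdf[OF diff_mem[OF v]]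
    by simp
  then show ?thesis unfolding uniform01_def uniform_distributed_iff by simp
qed

end

theorem mainTheorem2:
  fixes f :: "real \<Rightarrow> real" and C :: "real \<Rightarrow> real \<Rightarrow> real"
    and M :: "'a measure" and U V :: "'a \<Rightarrow> real"
  assumes "f \<in> {0..1} \<rightarrow> {0..1}"
    and "mono_on {0..1} f" and "f 1 = 1"
    and "\<forall>v\<in>{0..1}. f v \<ge> v"
    and "\<forall>v1\<in>{0..1}. \<forall>v2\<in>{0..1}. v1 \<noteq> v2 \<longrightarrow> (f v2 - f v1) / (v2 - v1) \<le> 1"
    and "prob_space M"
    and "uniform01 M U" and "uniform01 M V"
    and "copula C"
    and "\<forall>u\<in>{0..1}. \<forall>v\<in>{0..1}. \<P>(\<omega> in M. U \<omega> \<le> u \<and> V \<omega> \<le> v) = C u v"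
  shows "(\<forall>u\<in>{0..1}. \<forall>v\<in>{0..1}.
            \<P>(\<omega> in M. U \<omega> \<le> u \<and> g_of f (V \<omega>) \<le> v) = C u (f v) - C u (f v - v)) \<and>
         uniform01 M (\<lambda>\<omega>. g_of f (V \<omega>)) \<and>
         measure_preserving01 TYPE('b) (g_of f)"
proof -
  interpret slope_le_one f
    using assms(1-5) by unfold_locales auto
  have [measurable]: "U \<in> borel_measurable M"
    using assms(7) distributed_measurable unfolding uniform01_def by fastforce
  have "\<P>(\<omega> in M. U \<omega> \<le> u \<and> g_of f (V \<omega>) \<le> v) = C u (f v) - C u (f v - v)"
    if u: "u \<in> {0..1}" and v: "v \<in> {0..1}" for u v
    using prob_g_of_le[OF assms(6,8) v, of "\<lambda>\<omega>. U \<omega> \<le> u"] assms(10) u value_mem[OF v] diff_mem[OF v]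
    by simp
  \<comment> \<open>\<open>uniform01_g_of\<close> is polymorphic in the sample space, so it also
    applies over \<open>'b\<close>.\<close>
  moreover have "measure_preserving01 TYPE('b) (g_of f)"
    unfolding measure_preserving01_def using g_of_range uniform01_g_of by auto
  ultimately show ?thesis using uniform01_g_of[OF assms(6,8)] by blast
qed

end
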